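(* Let $(X,\sigma_X)$ and $(Y,\sigma_Y)$ be Deaconu-Renault systems on metric spaces $(X,d_X)$ and $(Y,d_Y)$, and let $\phi:X\to Y$ be a uniformly continuous factor map. Then $h_{d_X}(\sigma_X)\geq h_{d_Y}(\sigma_Y)$.
   Context: $\mathbb N=\{1,2,\dots\}$. A Deaconu-Renault system is a pair $(X,\sigma)$ with $X$ a locally compact Hausdorff space and $\sigma:Dom(\sigma)\to Im(\sigma)$ a local homeomorphism from an open set $Dom(\sigma)\subseteq X$ onto an open set $Im(\sigma)\subseteq X$. Put $Dom(\sigma^0)=X$, $\sigma^0=\mathrm{id}$, and inductively $Dom(\sigma^n)=\sigma^{-1}(Dom(\sigma^{n-1}))$, with $\sigma^n$ the $n$-fold composition, defined on $Dom(\sigma^n)$. A map $f:X\to Y$ between topological spaces is a compact covering if for every compact $K\subseteq Y$ there is a compact $C\subseteq X$ with $f(C)=K$. A factor map from $(X,\sigma_X)$ to $(Y,\sigma_Y)$ is a continuous, surjective, compact covering map $\phi:X\to Y$ such that $\phi(Dom(\sigma_X))\subseteq Dom(\sigma_Y)$, $\sigma_Y(\phi(x))=\phi(\sigma_X(x))$ for all $x\in Dom(\sigma_X)$, and $\phi^{-1}(Dom(\sigma_Y))\subseteq Dom(\sigma_X)$. Metric entropy of $(X,\sigma)$ on a metric space $(X,d)$ (the metric inducing the topology). For $n\in\mathbb N$, $x\in X$ let $I_n(x)=\{i\in\{0,\dots,n-1\}:x\in Dom(\sigma^i)\}$ and $d_n(x,y)=\max_{i\in I_n(x)\cap I_n(y)}d(\sigma^i(x),\sigma^i(y))$.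 For $K\subseteq X$ compact, $Z\subseteq X$ and $\varepsilon>0$, a set $A\subseteq K\cap Z$ is $(n,\varepsilon,\sigma,K\cap Z)$-separated if $d_n(x,y)>\varepsilon$ for all distinct $x,y\in A$; $sep(n,\varepsilon,\sigma,K\cap Z)$ is the largest cardinality of such a set ($\infty$ if there is no finite bound). Let $ssep(n,\varepsilon,\sigma,K)=\sup_F sep(n,\varepsilon,\sigma,K\cap F)$, the supremum being over all closed subsets $F$ of $X$ with $F\subseteq Dom(\sigma^{n-1})$. Define $h_\varepsilon(\sigma,K,d)=\limsup_{n\to\infty}\frac1n\log ssep(n,\varepsilon,\sigma,K)$ (in the extended reals, $\log\infty=\infty$, and with the convention $\log 0:=0$), $h_d(\sigma,K)=\lim_{\varepsilon\to0}h_\varepsilon(\sigma,K,d)$, and the metric entropy $h_d(\sigma)=\sup_K h_d(\sigma,K)$ over all compact $K\subseteq X$. *)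

theory Defs
  imports "HOL-Analysis.Analysis"
begin

text \<open>
  Spaces are abstract topologies (or bundled metrics) with an explicit carrier, so the empty
  space is allowed.  A partial map on a space is a pair of a domain \<open>D\<close> and a total HOL function
  \<open>\<sigma>\<close>, whose values outside \<open>D\<close> are never used.
\<close>

definition local_homeomorphism :: "'a topology \<Rightarrow> 'b topology \<Rightarrow> ('a \<Rightarrow> 'b) \<Rightarrow> bool" where
  "local_homeomorphism X Y f \<longleftrightarrow>
     (\<forall>x\<in>topspace X. \<exists>U. openin X U \<and> x \<in> U \<and> openin Y (f ` U) \<and>
        homeomorphic_map (subtopology X U) (subtopology Y (f ` U)) f)"

definition deaconu_renault :: "'a topology \<Rightarrow> 'a set \<Rightarrow> ('a \<Rightarrow> 'a) \<Rightarrow> bool" where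
  "deaconu_renault X D \<sigma> \<longleftrightarrow>
     locally_compact_space X \<and> Hausdorff_space X \<and>
     openin X D \<and> openin X (\<sigma> ` D) \<and>
     local_homeomorphism (subtopology X D) (subtopology X (\<sigma> ` D)) \<sigma>"

text \<open>\<open>iter_dom S D \<sigma> n\<close> is \<open>Dom(\<sigma>\<^sup>n)\<close>, where \<open>S\<close> is the carrier and \<open>D = Dom(\<sigma>)\<close>; on this set
  \<open>\<sigma>\<^sup>n\<close> is \<open>\<sigma> ^^ n\<close>.\<close>
primrec iter_dom :: "'a set \<Rightarrow> 'a set \<Rightarrow> ('a \<Rightarrow> 'a) \<Rightarrow> nat \<Rightarrow> 'a set" where
  "iter_dom S D \<sigma> 0 = S"
| "iter_dom S D \<sigma> (Suc n) = {x \<in> D. \<sigma> x \<in> iter_dom S D \<sigma> n}"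

definition compact_covering :: "'a topology \<Rightarrow> 'b topology \<Rightarrow> ('a \<Rightarrow> 'b) \<Rightarrow> bool" where
  "compact_covering X Y f \<longleftrightarrow>
     (\<forall>K. compactin Y K \<longrightarrow> (\<exists>C. compactin X C \<and> f ` C = K))"

definition factor_map ::
  "'a topology \<Rightarrow> 'a set \<Rightarrow> ('a \<Rightarrow> 'a) \<Rightarrow> 'b topology \<Rightarrow> 'b set \<Rightarrow> ('b \<Rightarrow> 'b) \<Rightarrow> ('a \<Rightarrow> 'b) \<Rightarrow> bool"
where
  "factor_map X DX \<sigma>X Y DY \<sigma>Y \<phi> \<longleftrightarrow>
     continuous_map X Y \<phi> \<and> \<phi> ` topspace X = topspace Y \<and> compact_covering X Y \<phi> \<and>
     \<phi> ` DX \<subseteq> DY \<and>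
     (\<forall>x\<in>DX. \<sigma>Y (\<phi> x) = \<phi> (\<sigma>X x)) \<and>
     {x \<in> topspace X. \<phi> x \<in> DY} \<subseteq> DX"

definition iter_indices :: "'a set \<Rightarrow> 'a set \<Rightarrow> ('a \<Rightarrow> 'a) \<Rightarrow> nat \<Rightarrow> 'a \<Rightarrow> nat set" where
  "iter_indices S D \<sigma> n x = {i. i < n \<and> x \<in> iter_dom S D \<sigma> i}"

text \<open>Meaningful for \<open>n \<ge> 1\<close> and points of the space, where the index set contains \<open>0\<close>.\<close>
definition iter_dist :: "'a metric \<Rightarrow> 'a set \<Rightarrow> ('a \<Rightarrow> 'a) \<Rightarrow> nat \<Rightarrow> 'a \<Rightarrow> 'a \<Rightarrow> real" where
  "iter_dist m D \<sigma> n x y =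
     Max ((\<lambda>i. mdist m ((\<sigma> ^^ i) x) ((\<sigma> ^^ i) y)) `
       (iter_indices (mspace m) D \<sigma> n x \<inter> iter_indices (mspace m) D \<sigma> n y))"

definition separated_set ::
  "'a metric \<Rightarrow> 'a set \<Rightarrow> ('a \<Rightarrow> 'a) \<Rightarrow> nat \<Rightarrow> real \<Rightarrow> 'a set \<Rightarrow> 'a set \<Rightarrow> bool" where
  "separated_set m D \<sigma> n \<epsilon> B A \<longleftrightarrow>
     A \<subseteq> B \<and> (\<forall>x\<in>A. \<forall>y\<in>A. x \<noteq> y \<longrightarrow> iter_dist m D \<sigma> n x y > \<epsilon>)"

definition sep :: "'a metric \<Rightarrow> 'a set \<Rightarrow> ('a \<Rightarrow> 'a) \<Rightarrow> nat \<Rightarrow> real \<Rightarrow> 'a set \<Rightarrow> enat" where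
  "sep m D \<sigma> n \<epsilon> B =
     (SUP A\<in>{A. separated_set m D \<sigma> n \<epsilon> B A}. if finite A then enat (card A) else \<infinity>)"

definition ssep :: "'a metric \<Rightarrow> 'a set \<Rightarrow> ('a \<Rightarrow> 'a) \<Rightarrow> nat \<Rightarrow> real \<Rightarrow> 'a set \<Rightarrow> enat" where
  "ssep m D \<sigma> n \<epsilon> K =
     (SUP F\<in>{F. closedin (mtopology_of m) F \<and> F \<subseteq> iter_dom (mspace m) D \<sigma> (n - 1)}.
        sep m D \<sigma> n \<epsilon> (K \<inter> F))"

text \<open>Logarithm of an extended natural number, with \<open>log 0 = 0\<close> and \<open>log \<infinity> = \<infinity>\<close>.\<close>
definition log_enat :: "enat \<Rightarrow> ereal" where
  "log_enat N = (case N of enat k \<Rightarrow> if k = 0 then 0 else ereal (ln (real k)) | \<infinity> \<Rightarrow> \<infinity>)"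

text \<open>The term \<open>n = 0\<close> has no meaning, but does not affect the upper limit.\<close>
definition entropy_eps :: "'a metric \<Rightarrow> 'a set \<Rightarrow> ('a \<Rightarrow> 'a) \<Rightarrow> 'a set \<Rightarrow> real \<Rightarrow> ereal" where
  "entropy_eps m D \<sigma> K \<epsilon> =
     limsup (\<lambda>n. ereal (1 / real n) * log_enat (ssep m D \<sigma> n \<epsilon> K))"

definition entropy_on :: "'a metric \<Rightarrow> 'a set \<Rightarrow> ('a \<Rightarrow> 'a) \<Rightarrow> 'a set \<Rightarrow> ereal" where
  "entropy_on m D \<sigma> K = Lim (at_right 0) (entropy_eps m D \<sigma> K)"

definition metric_entropy :: "'a metric \<Rightarrow> 'a set \<Rightarrow> ('a \<Rightarrow> 'a) \<Rightarrow> ereal" where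
  "metric_entropy m D \<sigma> = (SUP K\<in>{K. compactin (mtopology_of m) K}. entropy_on m D \<sigma> K)"

lemma log_enat_mono: "M \<le> N \<Longrightarrow> log_enat M \<le> log_enat N"
  by (cases M; cases N) (auto simp: log_enat_def)

lemma sep_antimono:
  assumes "\<delta> \<le> \<epsilon>"
  shows "sep m D \<sigma> n \<epsilon> B \<le> sep m D \<sigma> n \<delta> B"
  unfolding sep_def
  by (rule SUP_subset_mono) (use assms in \<open>force simp: separated_set_def\<close>)+

lemma entropy_eps_antimono:
  assumes "\<delta> \<le> \<epsilon>"
  shows "entropy_eps m D \<sigma> K \<epsilon> \<le> entropy_eps m D \<sigma> K \<delta>"
proof -
  have "ssep m D \<sigma> n \<epsilon> K \<le> ssep m D \<sigma> n \<delta> K" for n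
    unfolding ssep_def by (rule SUP_mono) (use sep_antimono[OF assms] in blast)
  then show ?thesis
    unfolding entropy_eps_def
    by (intro Limsup_mono always_eventually allI ereal_mult_left_mono log_enat_mono) auto
qed

text \<open>The limit in \<open>entropy_on\<close> always exists, so \<open>Lim\<close> is not a junk value there.\<close>
lemma entropy_eps_tendsto_SUP:
  "(entropy_eps m D \<sigma> K \<longlongrightarrow> (SUP \<epsilon>\<in>{0<..}. entropy_eps m D \<sigma> K \<epsilon>)) (at_right 0)"
proof (rule order_tendstoI)
  fix a assume "a < (SUP \<epsilon>\<in>{0<..}. entropy_eps m D \<sigma> K \<epsilon>)"
  then obtain e where e: "e > 0" "a < entropy_eps m D \<sigma> K e"
    by (auto simp: less_SUP_iff)
  have "a < entropy_eps m D \<sigma> K x" if "x < e" for x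
    using e(2) entropy_eps_antimono[of x e] that by (meson less_imp_le less_le_trans)
  then show "\<forall>\<^sub>F x in at_right 0. a < entropy_eps m D \<sigma> K x"
    using e(1) by (auto simp: eventually_at_right_field)
next
  fix a assume a: "(SUP \<epsilon>\<in>{0<..}. entropy_eps m D \<sigma> K \<epsilon>) < a"
  have "entropy_eps m D \<sigma> K x < a" if "x > 0" for x
    using a that by (meson SUP_upper greaterThan_iff le_less_trans)
  then show "\<forall>\<^sub>F x in at_right 0. entropy_eps m D \<sigma> K x < a"
    by (simp add: eventually_at_right_less eventually_mono[OF eventually_at_right_less])
qed

lemma tendsto_entropy_on: "(entropy_eps m D \<sigma> K \<longlongrightarrow> entropy_on m D \<sigma> K) (at_right 0)"
  unfolding entropy_on_def
  using entropy_eps_tendsto_SUP tendsto_Lim trivial_limit_at_right_real by metis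

end

theory Submission
  imports Defs
begin

text \<open>
  A factor map satisfies \<open>x \<in> Dom(\<sigma>\<^sub>X\<^sup>n) \<longleftrightarrow> \<phi> x \<in> Dom(\<sigma>\<^sub>Y\<^sup>n)\<close>, so a pair of points and its image
  have the same common indices, and by uniform continuity lifting a separated set along \<open>\<phi>\<close>
  yields a separated set of the same cardinality.  The lifts can be taken in a compact set
  covering \<open>K\<close> and in the closed set \<open>\<phi>\<^sup>-\<^sup>1(F)\<close>.
\<close>

lemma factor_map_funpow:
  assumes "factor_map X DX \<sigma>X Y DY \<sigma>Y \<phi>" "x \<in> iter_dom S DX \<sigma>X n"
  shows "\<phi> ((\<sigma>X ^^ n) x) = (\<sigma>Y ^^ n) (\<phi> x)"
  using assms(2)
proof (induction n arbitrary: x)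
  case (Suc n)
  then show ?case
    using assms(1) by (simp add: factor_map_def funpow_swap1)
qed simp

text \<open>The two domain conditions of a factor map together give
  \<open>\<phi> x \<in> DY \<longleftrightarrow> x \<in> DX\<close> for points of the space. Since
  \<open>\<sigma>X\<close> maps \<open>DX\<close> into the space, this equivalence applies again at
  \<open>\<sigma>X x\<close>, so the induction goes through.\<close>

lemma factor_map_iter_dom_iff:
  assumes "factor_map X DX \<sigma>X Y DY \<sigma>Y \<phi>"
    and "\<sigma>X ` DX \<subseteq> topspace X" "x \<in> topspace X"
  shows "\<phi> x \<in> iter_dom (topspace Y) DY \<sigma>Y n \<longleftrightarrow> x \<in> iter_dom (topspace X) DX \<sigma>X n"
  using assms(3)
proof (induction n arbitrary: x)
  case 0
  then show ?case
    using assms(1) by (auto simp: factor_map_def)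
next
  case (Suc n)
  have "\<phi> x \<in> DY \<longleftrightarrow> x \<in> DX"
    using assms(1) Suc.prems by (auto simp: factor_map_def)
  moreover have "\<sigma>Y (\<phi> x) = \<phi> (\<sigma>X x)" "\<sigma>X x \<in> topspace X" if "x \<in> DX"
    using assms(1,2) that by (auto simp: factor_map_def)
  ultimately show ?case
    using Suc.IH by auto
qed

lemma funpow_iter_dom_mem:
  assumes "\<sigma> ` D \<subseteq> S" "x \<in> iter_dom S D \<sigma> n"
  shows "(\<sigma> ^^ n) x \<in> S"
  using assms(2)
proof (induction n arbitrary: x)
  case (Suc n)
  then show ?case
    by (simp add: funpow_swap1)
qed simp

text \<open>For \<open>n > 0\<close> and points of the space, 0 is a common index, so the maximum is
  over a finite nonempty set and exceeds \<open>e\<close> exactly when some term does.\<close>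

lemma less_iter_dist_iff:
  assumes "x \<in> mspace m" "y \<in> mspace m" "n > 0"
  shows "e < iter_dist m D \<sigma> n x y \<longleftrightarrow>
    (\<exists>i \<in> iter_indices (mspace m) D \<sigma> n x \<inter> iter_indices (mspace m) D \<sigma> n y.
       e < mdist m ((\<sigma> ^^ i) x) ((\<sigma> ^^ i) y))"
proof -
  have "0 \<in> iter_indices (mspace m) D \<sigma> n x \<inter> iter_indices (mspace m) D \<sigma> n y"
    using assms by (simp add: iter_indices_def)
  then show ?thesis
    unfolding iter_dist_def by (subst Max_gr_iff) (auto simp: iter_indices_def)
qed

text \<open>Separation is strict, so uniform continuity is assumed with non-strict bounds: its
  contrapositive turns distances above \<open>\<epsilon>\<close> in the factor into distances above
  \<open>\<delta>\<close> upstairs.\<close>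

lemma ssep_factor_le:
  fixes mX :: "'a metric" and mY :: "'b metric"
  assumes dr: "deaconu_renault (mtopology_of mX) DX \<sigma>X"
    and fm: "factor_map (mtopology_of mX) DX \<sigma>X (mtopology_of mY) DY \<sigma>Y \<phi>"
    and unif: "\<And>x y. \<lbrakk>x \<in> mspace mX; y \<in> mspace mX; mdist mX x y \<le> \<delta>\<rbrakk>
                 \<Longrightarrow> mdist mY (\<phi> x) (\<phi> y) \<le> \<epsilon>"
    and C: "C \<subseteq> mspace mX" "\<phi> ` C = K" and n: "n > 0"
  shows "ssep mY DY \<sigma>Y n \<epsilon> K \<le> ssep mX DX \<sigma>X n \<delta> C"
  unfolding ssep_def
proof (rule SUP_mono, clarify)
  fix F assume F: "closedin (mtopology_of mY) F" "F \<subseteq> iter_dom (mspace mY) DY \<sigma>Y (n - 1)"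
  define G where "G = {x \<in> mspace mX. \<phi> x \<in> F}"
  have range: "\<sigma>X ` DX \<subseteq> mspace mX"
    using dr openin_subset[of "mtopology_of mX"] by (auto simp: deaconu_renault_def)
  have dom_iff: "\<phi> x \<in> iter_dom (mspace mY) DY \<sigma>Y i \<longleftrightarrow> x \<in> iter_dom (mspace mX) DX \<sigma>X i"
    if "x \<in> mspace mX" for x i
    using factor_map_iter_dom_iff[OF fm] range that by simp
  have \<phi>_mem: "\<phi> x \<in> mspace mY" if "x \<in> mspace mX" for x
    using fm that by (auto simp: factor_map_def)
  have "continuous_map (mtopology_of mX) (mtopology_of mY) \<phi>"
    using fm by (simp add: factor_map_def)
  \<comment> \<open>Continuity makes the preimage \<open>G\<close> closed, and
    \<open>dom_iff\<close> at \<open>n - 1\<close> puts it inside the required domain, so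
    \<open>G\<close> is admissible in the supremum for \<open>mX\<close>.\<close>
  from closedin_continuous_map_preimage[OF this F(1)]
  have G: "closedin (mtopology_of mX) G" "G \<subseteq> iter_dom (mspace mX) DX \<sigma>X (n - 1)"
    using F(2) dom_iff by (auto simp: G_def)
  have "sep mY DY \<sigma>Y n \<epsilon> (K \<inter> F) \<le> sep mX DX \<sigma>X n \<delta> (C \<inter> G)"
    unfolding sep_def
  proof (rule SUP_mono, clarify)
    fix A assume A: "separated_set mY DY \<sigma>Y n \<epsilon> (K \<inter> F) A"
    then have "A \<subseteq> \<phi> ` (C \<inter> G)"
      using C by (force simp: separated_set_def G_def)
    \<comment> \<open>\<open>B\<close> picks one preimage for each point of \<open>A\<close>;
      injectivity on \<open>B\<close> preserves cardinality, including the infinite case.\<close>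
    then obtain B where B: "B \<subseteq> C \<inter> G" "inj_on \<phi> B" "A = \<phi> ` B"
      by (auto simp: subset_image_inj)
    have "\<delta> < iter_dist mX DX \<sigma>X n x y" if xy: "x \<in> B" "y \<in> B" "x \<noteq> y" for x y
    proof -
      have mem: "x \<in> mspace mX" "y \<in> mspace mX"
        using xy B(1) C(1) by auto
      have "\<epsilon> < iter_dist mY DY \<sigma>Y n (\<phi> x) (\<phi> y)"
        using A B xy by (auto simp: separated_set_def inj_on_eq_iff)
      \<comment> \<open>An index witnessing separation of the images is, by \<open>dom_iff\<close>,
        also a common index of \<open>x\<close> and \<open>y\<close>.\<close>
      then obtain i where i: "i < n" "x \<in> iter_dom (mspace mX) DX \<sigma>X i"
          "y \<in> iter_dom (mspace mX) DX \<sigma>X i"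
          "\<epsilon> < mdist mY ((\<sigma>Y ^^ i) (\<phi> x)) ((\<sigma>Y ^^ i) (\<phi> y))"
        using n mem by (auto simp: less_iter_dist_iff \<phi>_mem iter_indices_def dom_iff)
      then have "\<delta> < mdist mX ((\<sigma>X ^^ i) x) ((\<sigma>X ^^ i) y)"
        using unif[of "(\<sigma>X ^^ i) x" "(\<sigma>X ^^ i) y"] funpow_iter_dom_mem[OF range]
        by (force simp: factor_map_funpow[OF fm])
      then show ?thesis
        using n mem i by (auto simp: less_iter_dist_iff iter_indices_def)
    qed
    then have "separated_set mX DX \<sigma>X n \<delta> (C \<inter> G) B"
      using B(1) by (auto simp: separated_set_def)
    moreover have "card A = card B" "finite A \<longleftrightarrow> finite B"
      using B by (auto simp: card_image finite_image_iff)
    ultimately show "\<exists>B\<in>{B. separated_set mX DX \<sigma>X n \<delta> (C \<inter> G) B}.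
        (if finite A then enat (card A) else \<infinity>) \<le> (if finite B then enat (card B) else \<infinity>)"
      by auto
  qed
  then show "\<exists>G\<in>{G. closedin (mtopology_of mX) G \<and> G \<subseteq> iter_dom (mspace mX) DX \<sigma>X (n - 1)}.
      sep mY DY \<sigma>Y n \<epsilon> (K \<inter> F) \<le> sep mX DX \<sigma>X n \<delta> (C \<inter> G)"
    using G by blast
qed

text \<open>An upper limit depends only on large \<open>n\<close>, so the meaningless term at
  \<open>n = 0\<close> can be left out of the comparison.\<close>

lemma entropy_eps_le_of_ssep_le:
  assumes "\<And>n. n > 0 \<Longrightarrow> ssep m D \<sigma> n \<epsilon> K \<le> ssep m' D' \<sigma>' n \<delta> C"
  shows "entropy_eps m D \<sigma> K \<epsilon> \<le> entropy_eps m' D' \<sigma>' C \<delta>"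
  unfolding entropy_eps_def
proof (rule Limsup_mono, rule eventually_mono[OF eventually_gt_at_top[of 0]])
  fix n :: nat assume "0 < n"
  then show "ereal (1 / real n) * log_enat (ssep m D \<sigma> n \<epsilon> K)
      \<le> ereal (1 / real n) * log_enat (ssep m' D' \<sigma>' n \<delta> C)"
    by (intro ereal_mult_left_mono log_enat_mono assms) auto
qed

text \<open>In supremum form it suffices to find, for each \<open>\<epsilon>\<close>, some
  \<open>\<delta>\<close> with a larger entropy; no relation between the two rates of convergence
  has to be tracked.\<close>

lemma entropy_on_eq_SUP: "entropy_on m D \<sigma> K = (SUP \<epsilon>\<in>{0<..}. entropy_eps m D \<sigma> K \<epsilon>)"
  by (rule tendsto_unique[OF trivial_limit_at_right_real tendsto_entropy_on entropy_eps_tendsto_SUP])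

theorem theorem4p6:
  fixes mX :: "'a metric" and DX :: "'a set" and \<sigma>X :: "'a \<Rightarrow> 'a"
    and mY :: "'b metric" and DY :: "'b set" and \<sigma>Y :: "'b \<Rightarrow> 'b"
    and \<phi> :: "'a \<Rightarrow> 'b"
  assumes "deaconu_renault (mtopology_of mX) DX \<sigma>X"
    and "deaconu_renault (mtopology_of mY) DY \<sigma>Y"
    and "factor_map (mtopology_of mX) DX \<sigma>X (mtopology_of mY) DY \<sigma>Y \<phi>"
    and "uniformly_continuous_map mX mY \<phi>"
  shows "metric_entropy mX DX \<sigma>X \<ge> metric_entropy mY DY \<sigma>Y"
  unfolding metric_entropy_def
proof (rule SUP_mono, clarify)
  fix K assume "compactin (mtopology_of mY) K"
  \<comment> \<open>The compact covering property supplies \<open>C\<close>, since the full preimage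
    of \<open>K\<close> may fail to be compact.\<close>
  then obtain C where C: "compactin (mtopology_of mX) C" "\<phi> ` C = K"
    using assms(3) unfolding factor_map_def compact_covering_def by blast
  then have C_sub: "C \<subseteq> mspace mX"
    using compactin_subset_topspace by fastforce
  have "entropy_on mY DY \<sigma>Y K \<le> entropy_on mX DX \<sigma>X C"
    unfolding entropy_on_eq_SUP
  proof (rule SUP_mono)
    fix \<epsilon> :: real assume "\<epsilon> \<in> {0<..}"
    then obtain d where d: "d > 0" "\<And>x y. \<lbrakk>x \<in> mspace mX; y \<in> mspace mX; mdist mX y x < d\<rbrakk>
        \<Longrightarrow> mdist mY (\<phi> y) (\<phi> x) < \<epsilon>"
      using assms(4) unfolding uniformly_continuous_map_def by (metis greaterThan_iff)
    \<comment> \<open>Halving \<open>d\<close> turns the strict bound from uniform continuity into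
      the non-strict one required by \<open>ssep_factor_le\<close>.\<close>
    have "mdist mY (\<phi> x) (\<phi> y) \<le> \<epsilon>"
      if "x \<in> mspace mX" "y \<in> mspace mX" "mdist mX x y \<le> d / 2" for x y
      using d(1) d(2)[of y x] that by simp
    from ssep_factor_le[OF assms(1,3) this C_sub C(2)]
    have "entropy_eps mY DY \<sigma>Y K \<epsilon> \<le> entropy_eps mX DX \<sigma>X C (d / 2)"
      by (intro entropy_eps_le_of_ssep_le) auto
    then show "\<exists>\<delta>\<in>{0<..}. entropy_eps mY DY \<sigma>Y K \<epsilon> \<le> entropy_eps mX DX \<sigma>X C \<delta>"
      using d(1) by (intro bexI[of _ "d / 2"]) auto
  qed
  then show "\<exists>C\<in>{C. compactin (mtopology_of mX) C}.
      entropy_on mY DY \<sigma>Y K \<le> entropy_on mX DX \<sigma>X C"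
    using C(1) by blast
qed

end
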